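(* For every connected graph $H$ (with at least three nodes, of constant size) and every $r \geq r_H$, where $r_H = \widetilde{\operatorname{diam}}(H) - 1$, the $r$-round bandwidth complexity of $\textsc{MemList}(H)$ under edge deletions is $O((\log n)/r)$.
   Context: Node-edge distance: $\operatorname{dist}_G(u,\{v,w\}) = 1 + \min\{\operatorname{dist}_G(u,v), \operatorname{dist}_G(u,w)\}$; $\widetilde{\operatorname{diam}}(G) = \max_{u \in V(G)} \max_{e \in E(G)} \operatorname{dist}_G(u,e)$. Dynamic network model: a sequence of graphs $G^0, G^1, \ldots$ on $n$ nodes, each obtained from the previous by at most one edge deletion; nodes have distinct IDs from $[n]$, know their neighbors' IDs and initially the whole of $G^0$; communication is synchronous, each round the change happens first, then each node sends a $B$-bit message to each neighbor; nodes detect changes only via their neighbor lists; algorithms are deterministic. An $r$-round algorithm works under the promise that each change at round $i$ is followed by $r-1$ change-free rounds and must output correctly for $G^i$ by the end of round $i+r-1$. The $r$-round bandwidth complexity is the minimum such $B$. $\textsc{MemList}(H)$: each node $v$ lists all subgraphs isomorphic to $H$ containing $v$. *)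

theory Defs
  imports Complex_Main "HOL-Library.Extended_Nat"
begin

record 'a ugraph =
  verts :: "'a set"
  edges :: "'a set set"

definition simple_graph :: "'a ugraph \<Rightarrow> bool" where
  "simple_graph G \<longleftrightarrow> finite (verts G) \<and> (\<forall>e\<in>edges G. e \<subseteq> verts G \<and> card e = 2)"

definition neighbors :: "'a ugraph \<Rightarrow> 'a \<Rightarrow> 'a set" where
  "neighbors G v = {u. {u, v} \<in> edges G}"

definition walk :: "'a ugraph \<Rightarrow> 'a \<Rightarrow> 'a list \<Rightarrow> 'a \<Rightarrow> bool" where
  "walk G u p v \<longleftrightarrow> p \<noteq> [] \<and> hd p = u \<and> last p = v \<and> set p \<subseteq> verts G
     \<and> successively (\<lambda>x y. {x, y} \<in> edges G) p"

definition connected_graph :: "'a ugraph \<Rightarrow> bool" where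
  "connected_graph G \<longleftrightarrow> verts G \<noteq> {} \<and> (\<forall>u\<in>verts G. \<forall>v\<in>verts G. \<exists>p. walk G u p v)"

text \<open>Distances count edges; they are \<open>\<infinity>\<close> between different components.\<close>

definition graph_dist :: "'a ugraph \<Rightarrow> 'a \<Rightarrow> 'a \<Rightarrow> enat" where
  "graph_dist G u v = (INF p\<in>{p. walk G u p v}. enat (length p - 1))"

definition node_edge_dist :: "'a ugraph \<Rightarrow> 'a \<Rightarrow> 'a set \<Rightarrow> enat" where
  "node_edge_dist G u e = 1 + Min (graph_dist G u ` e)"

definition node_edge_diam :: "'a ugraph \<Rightarrow> enat" where
  "node_edge_diam G = (SUP u\<in>verts G. SUP e\<in>edges G. node_edge_dist G u e)"

definition round_threshold :: "'a ugraph \<Rightarrow> enat" where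
  "round_threshold H = node_edge_diam H - 1"

definition subgraph :: "'a ugraph \<Rightarrow> 'a ugraph \<Rightarrow> bool" where
  "subgraph S G \<longleftrightarrow> simple_graph S \<and> verts S \<subseteq> verts G \<and> edges S \<subseteq> edges G"

definition graph_iso :: "'a ugraph \<Rightarrow> 'b ugraph \<Rightarrow> bool" where
  "graph_iso H S \<longleftrightarrow> (\<exists>f. bij_betw f (verts H) (verts S) \<and> edges S = (\<lambda>e. f ` e) ` edges H)"

text \<open>A problem assigns to every graph and every node the output required of that node.\<close>

type_synonym 'o problem = "nat ugraph \<Rightarrow> nat \<Rightarrow> 'o"

definition MemList :: "'h ugraph \<Rightarrow> nat ugraph set problem" where
  "MemList H G v = {S. subgraph S G \<and> graph_iso H S \<and> v \<in> verts S}"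

text \<open>
  The nodes of an \<open>n\<close>-node network are identified with their IDs \<open>1, \<dots>, n\<close>. The graph
  \<open>G i\<close> is the one present during round \<open>i\<close>; rounds are numbered from 1, and \<open>G 0\<close> is the
  initial graph.
\<close>

definition deletion_sequence :: "nat \<Rightarrow> (nat \<Rightarrow> nat ugraph) \<Rightarrow> bool" where
  "deletion_sequence n G \<longleftrightarrow> simple_graph (G 0) \<and> verts (G 0) = {1..n} \<and>
     (\<forall>i. G (Suc i) = G i \<or>
          (\<exists>e\<in>edges (G i). G (Suc i) = (G i)\<lparr>edges := edges (G i) - {e}\<rparr>))"

definition change_at :: "(nat \<Rightarrow> nat ugraph) \<Rightarrow> nat \<Rightarrow> bool" where
  "change_at G i \<longleftrightarrow> i \<ge> 1 \<and> G i \<noteq> G (i - 1)"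

definition spaced :: "nat \<Rightarrow> (nat \<Rightarrow> nat ugraph) \<Rightarrow> bool" where
  "spaced r G \<longleftrightarrow> (\<forall>i. change_at G i \<longrightarrow> (\<forall>j\<in>{i<..<i + r}. \<not> change_at G j))"

text \<open>
  What a node observes in one round: its neighbor list after the change of that round, and the
  message received from each of these neighbors.

  Since local computation is unrestricted and algorithms are deterministic, an algorithm is given
  by functions of everything the node has observed. The arguments of \<open>send\<close> are the ID of the
  sender, the initial graph, the observations of the previous rounds, the neighbor list in the
  current round, and the recipient; those of \<open>out\<close> are the ID of the node, the initial graph, and
  the observations of all rounds completed so far.
\<close>

type_synonym message = "bool list"
type_synonym observation = "nat set \<times> (nat \<rightharpoonup> message)"

record 'o algorithm =
  send :: "nat \<Rightarrow> nat ugraph \<Rightarrow> observation list \<Rightarrow> nat set \<Rightarrow> nat \<Rightarrow> message"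
  out :: "nat \<Rightarrow> nat ugraph \<Rightarrow> observation list \<Rightarrow> 'o"

fun history :: "'o algorithm \<Rightarrow> (nat \<Rightarrow> nat ugraph) \<Rightarrow> nat \<Rightarrow> nat \<Rightarrow> observation list" where
  "history A G 0 v = []"
| "history A G (Suc i) v = history A G i v @
     [(neighbors (G (Suc i)) v,
       \<lambda>u. if u \<in> neighbors (G (Suc i)) v
           then Some (send A u (G 0) (history A G i u) (neighbors (G (Suc i)) u) v)
           else None)]"

definition output_at :: "'o algorithm \<Rightarrow> (nat \<Rightarrow> nat ugraph) \<Rightarrow> nat \<Rightarrow> nat \<Rightarrow> 'o" where
  "output_at A G t v = out A v (G 0) (history A G t v)"

definition has_bandwidth :: "'o algorithm \<Rightarrow> nat \<Rightarrow> bool" where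
  "has_bandwidth A B \<longleftrightarrow> (\<forall>v G0 h N u. length (send A v G0 h N u) = B)"

text \<open>
  Outputs are required to be correct for \<open>G i\<close> at the end of round \<open>i + r - 1\<close> for each round \<open>i\<close>
  followed by \<open>r - 1\<close> change-free rounds. By the promise this includes all rounds in which a
  change occurs; it also forces outputs to stay correct while nothing changes. Meaningful for
  \<open>r \<ge> 1\<close>.
\<close>

definition solves :: "'o algorithm \<Rightarrow> 'o problem \<Rightarrow> nat \<Rightarrow> nat \<Rightarrow> bool" where
  "solves A P r n \<longleftrightarrow> (\<forall>G. deletion_sequence n G \<and> spaced r G \<longrightarrow>
     (\<forall>i. (\<forall>j\<in>{i<..<i + r}. \<not> change_at G j) \<longrightarrow>
        (\<forall>v\<in>{1..n}. output_at A G (i + r - 1) v = P (G i) v)))"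

text \<open>The infimum over \<open>enat\<close> is a minimum, or \<open>\<infinity>\<close> if no bandwidth suffices.\<close>

definition bandwidth_complexity :: "'o problem \<Rightarrow> nat \<Rightarrow> nat \<Rightarrow> enat" where
  "bandwidth_complexity P r n =
     (INF B\<in>{B. \<exists>A. has_bandwidth A B \<and> solves A P r n}. enat B)"

end

theory Submission
  imports Defs "HOL-Library.FuncSet"
begin

text \<open>
  Time is cut into blocks of \<open>q = (r + 1) div (R + 1)\<close> rounds, where \<open>R\<close> is the round threshold,
  and one message about a deleted edge, together with a hop count, is transmitted per block. The
  end points of a deleted edge start a flood at the next block boundary and the flood is stopped
  after \<open>R\<close> hops. Waiting for the boundary costs at most \<open>q - 1\<close> rounds, so the flood ends
  within \<open>R q + q - 1 \<le> r\<close> rounds, before the next deletion; hence floods never interfere. If \<open>e\<close>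
  is the first edge of a copy of \<open>H\<close> to disappear, then every node of the copy has a walk of
  length at most \<open>R\<close> to \<open>e\<close> that uses only the remaining edges of the copy, so it learns about the
  deletion in time.
\<close>

section \<open>Walks and node-edge distances\<close>

text \<open>A finite bound rules out the empty infimum, and a nonempty set of \<open>enat\<close>
  values contains its infimum because \<open>enat\<close> is well-ordered.\<close>

lemma ex_graph_dist_walk:
  assumes "graph_dist G u v \<le> enat d"
  shows "\<exists>p. walk G u p v \<and> length p \<le> Suc d"
proof -
  let ?A = "(\<lambda>p. enat (length p - 1)) ` {p. walk G u p v}"
  have "?A \<noteq> {}"
    using assms unfolding graph_dist_def by (intro notI) (simp add: Inf_enat_def)
  then have "Inf ?A \<in> ?A"
    by (metis Inf_enat_def LeastI_ex ex_in_conv)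
  then show ?thesis
    using assms unfolding graph_dist_def by force
qed

lemma graph_dist_ge_1:
  assumes "u \<noteq> v"
  shows "1 \<le> graph_dist G u v"
proof -
  have "1 \<le> enat (length p - 1)" if "walk G u p v" for p
  proof -
    have "length p \<ge> 2"
      using that assms unfolding walk_def by (cases p; cases "tl p") auto
    then show ?thesis by (simp add: one_enat_def)
  qed
  then show ?thesis
    unfolding graph_dist_def by (auto intro: INF_greatest)
qed

text \<open>The 1 in the node-edge distance cancels against \<open>Suc d\<close>, which leaves at
  most \<open>d\<close> steps to the nearer end point of \<open>e\<close>, hence at most
  \<open>Suc d\<close> nodes.\<close>

lemma node_edge_diam_walk:
  assumes "node_edge_diam G \<le> enat (Suc d)" "u \<in> verts G" "e \<in> edges G" "card e = 2"
  shows "\<exists>p. p \<noteq> [] \<and> hd p = u \<and> last p \<in> e \<and> length p \<le> Suc d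
    \<and> successively (\<lambda>x y. {x, y} \<in> edges G) p"
proof -
  have "node_edge_dist G u e \<le> node_edge_diam G"
    unfolding node_edge_diam_def using assms(2,3) by (meson SUP_upper order_trans)
  with assms(1) have "1 + Min (graph_dist G u ` e) \<le> enat (Suc d)"
    unfolding node_edge_dist_def by (rule order_trans[rotated])
  then have "Min (graph_dist G u ` e) \<le> enat d"
    by (cases "Min (graph_dist G u ` e)") (auto simp: one_enat_def)
  moreover have "finite e" "e \<noteq> {}"
    using assms(4) by (auto simp: card_2_iff)
  ultimately obtain x where "x \<in> e" "graph_dist G u x \<le> enat d"
    by (auto simp: Min_le_iff)
  then show ?thesis
    using ex_graph_dist_walk[of G u x d] unfolding walk_def by metis
qed

text \<open>Some edge misses one of the three or more nodes, and that node has distance at least 1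
  to both end points. This gives \<open>R\<close> at least 1, so a detected deletion is announced at
  all.\<close>

lemma node_edge_diam_ge_2:
  assumes "simple_graph G" "connected_graph G" "card (verts G) \<ge> 3"
  shows "2 \<le> node_edge_diam G"
proof -
  have fin: "finite (verts G)" using assms(1) unfolding simple_graph_def by simp
  obtain u where u: "u \<in> verts G" using assms(2) unfolding connected_graph_def by auto
  have "\<exists>v. v \<in> verts G \<and> v \<noteq> u"
  proof (rule ccontr)
    assume "\<not> ?thesis"
    then have "verts G \<subseteq> {u}" by auto
    then have "card (verts G) \<le> 1" by (metis card_mono finite.intros is_singletonI is_singleton_altdef)
    then show False using assms(3) by simp
  qed
  then obtain v where v: "v \<in> verts G" "v \<noteq> u" by auto
  obtain p where p: "walk G u p v" using assms(2) u v unfolding connected_graph_def by blast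
  then obtain x xs where p_eq: "p = u # x # xs"
    using v unfolding walk_def by (cases p; cases "tl p") auto
  have e: "{u, x} \<in> edges G" using p unfolding walk_def p_eq by simp
  have "\<not> verts G \<subseteq> {u, x}"
  proof
    assume "verts G \<subseteq> {u, x}"
    then have "card (verts G) \<le> card {u, x}" by (intro card_mono) auto
    also have "\<dots> \<le> 2" by (simp add: card_insert_if)
    finally show False using assms(3) by simp
  qed
  then obtain w where w: "w \<in> verts G" "w \<noteq> u" "w \<noteq> x" by auto
  have "1 \<le> Min (graph_dist G w ` {u, x})"
    using graph_dist_ge_1[OF w(2)] graph_dist_ge_1[OF w(3)] by (subst Min_ge_iff) auto
  then have "2 \<le> node_edge_dist G w {u, x}"
    unfolding node_edge_dist_def by (metis add_left_mono one_add_one)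
  also have "\<dots> \<le> node_edge_diam G"
    unfolding node_edge_diam_def using w(1) e by (meson SUP_upper order_trans)
  finally show ?thesis .
qed

text \<open>Stop a walk towards an edge as soon as it meets the edge.\<close>

lemma walk_avoiding_edge:
  assumes "p \<noteq> []" "last p \<in> e" "successively (\<lambda>x y. {x, y} \<in> E) p"
  shows "\<exists>p'. p' \<noteq> [] \<and> hd p' = hd p \<and> last p' \<in> e \<and> length p' \<le> length p
    \<and> successively (\<lambda>x y. {x, y} \<in> E - {e}) p'"
  using assms
proof (induction p)
  case (Cons v p)
  show ?case
  proof (cases "v \<in> e")
    case True
    then show ?thesis by (intro exI[of _ "[v]"]) auto
  next
    case False
    then have "p \<noteq> []" using Cons.prems by auto
    then obtain p' where p': "p' \<noteq> []" "hd p' = hd p" "last p' \<in> e" "length p' \<le> length p"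
      "successively (\<lambda>x y. {x, y} \<in> E - {e}) p'"
      using Cons by (auto simp: successively_Cons)
    have "{v, hd p} \<in> E - {e}"
      using Cons.prems \<open>p \<noteq> []\<close> False by (auto simp: successively_Cons)
    with p' show ?thesis
      by (intro exI[of _ "v # p'"]) (auto simp: successively_Cons)
  qed
qed simp

section \<open>Histories and deletion sequences\<close>

lemma length_history [simp]: "length (history A G t v) = t"
  by (induction t) auto

lemma nth_history:
  assumes "s < t"
  shows "history A G t v ! s = (neighbors (G (Suc s)) v,
    \<lambda>u. if u \<in> neighbors (G (Suc s)) v
        then Some (send A u (G 0) (history A G s u) (neighbors (G (Suc s)) u) v) else None)"
  using assms
proof (induction t)
  case (Suc t)
  then show ?case by (cases "s = t") (auto simp: nth_append)
qed simp

text \<open>Position \<open>s\<close> of a history belongs to round \<open>s + 1\<close>; putting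
  the initial neighbors in front makes list index and round number agree.\<close>

lemma nth_neighbor_lists:
  assumes "i \<le> Suc t"
  shows "(neighbors (G 0) v # map fst (history A G t v) @ [neighbors (G (Suc t)) v]) ! i
    = neighbors (G i) v"
  using assms by (cases i) (auto simp: nth_append nth_history less_Suc_eq)

lemma deletion_sequence_step:
  assumes "deletion_sequence n G"
  shows "edges (G (Suc i)) \<subseteq> edges (G i)" "verts (G (Suc i)) = verts (G i)"
    "e \<in> edges (G i) - edges (G (Suc i)) \<Longrightarrow> edges (G (Suc i)) = edges (G i) - {e}"
proof -
  have "G (Suc i) = G i \<or> (\<exists>e\<in>edges (G i). G (Suc i) = (G i)\<lparr>edges := edges (G i) - {e}\<rparr>)"
    using assms unfolding deletion_sequence_def by blast
  then show "edges (G (Suc i)) \<subseteq> edges (G i)" "verts (G (Suc i)) = verts (G i)"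
    "e \<in> edges (G i) - edges (G (Suc i)) \<Longrightarrow> edges (G (Suc i)) = edges (G i) - {e}"
    by auto
qed

lemma deletion_sequence_antimono:
  assumes "deletion_sequence n G" "i \<le> j"
  shows "edges (G j) \<subseteq> edges (G i)"
  using assms(2)
  by (induction rule: dec_induct) (use deletion_sequence_step(1)[OF assms(1)] in blast)+

lemma deletion_sequence_verts:
  assumes "deletion_sequence n G"
  shows "verts (G i) = {1..n}"
  using assms
  by (induction i) (auto simp: deletion_sequence_step(2)[OF assms] deletion_sequence_def)

lemma no_change_eq:
  assumes "\<forall>j\<in>{i<..<k}. \<not> change_at G j" "i \<le> s" "s < k"
  shows "G s = G i"
  using assms(2,3)
proof (induction rule: dec_induct)
  case (step s)
  then have "\<not> change_at G (Suc s)" using assms(1) by auto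
  then show ?case using step unfolding change_at_def by auto
qed simp

section \<open>Block codes\<close>

text \<open>There are \<open>2 ^ (q * B)\<close> sequences of \<open>q\<close> words of
  \<open>B\<close> bits, so \<open>X\<close> injects into them.\<close>

lemma ex_block_code:
  assumes "finite X" "card X \<le> 2 ^ (q * B)"
  shows "\<exists>chunk :: 'a \<Rightarrow> nat \<Rightarrow> bool list. (\<forall>x j. length (chunk x j) = B) \<and>
    (\<forall>x\<in>X. \<forall>y\<in>X. (\<forall>j<q. chunk x j = chunk y j) \<longrightarrow> x = y)"
proof -
  let ?L = "{bs :: bool list. length bs = B}"
  have "card ?L = 2 ^ B"
    using card_lists_length_eq[of "UNIV :: bool set" B] by simp
  then have "card ({..<q} \<rightarrow>\<^sub>E ?L) = 2 ^ (q * B)"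
    by (simp add: card_PiE power_mult mult.commute)
  moreover have "finite ({..<q} \<rightarrow>\<^sub>E ?L)"
    using finite_lists_length_eq[of "UNIV :: bool set" B] by (intro finite_PiE) auto
  ultimately obtain f where f: "f ` X \<subseteq> {..<q} \<rightarrow>\<^sub>E ?L" "inj_on f X"
    using assms by (metis card_le_inj)
  \<comment> \<open>The padding makes every chunk exactly \<open>B\<close> bits long, even for
    arguments that are never transmitted.\<close>
  define chunk where
    "chunk x j = (if x \<in> X \<and> j < q then f x j else replicate B False)" for x j
  have "length (chunk x j) = B" for x j
    using f(1) unfolding chunk_def by (auto dest!: PiE_mem)
  moreover have "x = y" if "x \<in> X" "y \<in> X" "\<forall>j<q. chunk x j = chunk y j" for x y
  proof -
    have "f x = f y"
    proof (rule PiE_ext)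
      show "f x \<in> {..<q} \<rightarrow>\<^sub>E ?L" "f y \<in> {..<q} \<rightarrow>\<^sub>E ?L" using f(1) that by auto
      show "f x j = f y j" if "j \<in> {..<q}" for j
        using that \<open>x \<in> X\<close> \<open>y \<in> X\<close> \<open>\<forall>j<q. chunk x j = chunk y j\<close> by (auto simp: chunk_def)
    qed
    then show ?thesis using f(2) that by (auto dest: inj_onD)
  qed
  ultimately show ?thesis by blast
qed

text \<open>Rounding \<open>q\<close> down costs at most a factor 2, so \<open>r\<close> is at most
  \<open>2 * q * (R + 1)\<close>; the factor \<open>R + 2\<close> in \<open>B\<close> is the
  exponent of \<open>n\<close>.\<close>

lemma block_capacity:
  fixes n r R q :: nat
  assumes "n \<ge> 1" "r \<ge> R" "R \<ge> 1"
  defines "q \<equiv> (r + 1) div (R + 1)"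
    and "B \<equiv> nat \<lceil>real (2 * (R + 1) * (R + 2)) * (log 2 (real n) / real r)\<rceil>"
  shows "n ^ (R + 2) \<le> 2 ^ (q * B)"
proof -
  have "r + 1 < (q + 1) * (R + 1)"
    unfolding q_def using dividend_less_div_times[of "R + 1" "r + 1"] by simp
  also have "\<dots> \<le> (2 * q) * (R + 1)"
  proof -
    have "q \<ge> 1" unfolding q_def using assms(2) by (simp add: Suc_le_eq div_greater_zero_iff)
    then show ?thesis by (intro mult_le_mono1) simp
  qed
  finally have "r \<le> 2 * q * (R + 1)" by simp
  then have "real r \<le> real (2 * q * (R + 1))" by (rule of_nat_mono)
  moreover have "log 2 (real n) \<ge> 0" using assms(1) by simp
  ultimately have "real r * (real (R + 2) * log 2 (real n))
      \<le> real (2 * q * (R + 1)) * (real (R + 2) * log 2 (real n))"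
    by (intro mult_right_mono) auto
  then have "real (R + 2) * log 2 (real n)
      \<le> real q * (real (2 * (R + 1) * (R + 2)) * (log 2 (real n) / real r))"
    using assms(2,3) by (simp add: field_simps)
  also have "\<dots> \<le> real q * real B"
    unfolding B_def by (intro mult_left_mono real_nat_ceiling_ge) simp
  finally have "log 2 (real n ^ (R + 2)) \<le> real (q * B)"
    using assms(1) by (subst log_nat_power) simp_all
  then have "real n ^ (R + 2) \<le> 2 powr real (q * B)"
    using assms(1) by (simp add: log_le_iff)
  then have "real (n ^ (R + 2)) \<le> real (2 ^ (q * B))"
    by (simp only: powr_realpow of_nat_power of_nat_numeral zero_less_numeral)
  then show ?thesis by (simp only: of_nat_le_iff)
qed

section \<open>The flooding algorithm\<close>

definition notices :: "nat \<Rightarrow> nat \<Rightarrow> (nat set \<times> nat) set" where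
  "notices n R = {e. e \<subseteq> {1..n} \<and> card e = 2} \<times> {..<R}"

lemma finite_notices: "finite (notices n R)"
proof -
  have "finite {e. e \<subseteq> {1..n} \<and> card e = 2}" by (rule finite_subset[of _ "Pow {1..n}"]) auto
  then show ?thesis unfolding notices_def by simp
qed

lemma card_notices:
  assumes "n \<ge> 1"
  shows "card (insert None (Some ` notices n R)) \<le> n ^ (R + 2)"
\<comment> \<open>A single node has no edges, so silence is the only value. The other case needs
  \<open>n\<close> at least 2 to bound \<open>Suc R\<close> by \<open>n ^ R\<close>.\<close>
proof (cases "n = 1")
  case True
  have "card {e. e \<subseteq> {1..n} \<and> card e = 2} = 0"
    using n_subsets[of "{1..n}" 2] True by simp
  then have "notices n R = {}" using True unfolding notices_def by simp
  then show ?thesis by (simp add: True)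
next
  case False
  have "card (notices n R) = (n choose 2) * R"
    using n_subsets[of "{1..n}" 2] unfolding notices_def by (simp add: card_cartesian_product)
  then have "card (insert None (Some ` notices n R)) = Suc ((n choose 2) * R)"
    using finite_notices by (subst card_insert_disjoint) (auto simp: card_image)
  also have "\<dots> \<le> n\<^sup>2 + n\<^sup>2 * R"
  proof -
    have "(n choose 2) * R \<le> n\<^sup>2 * R"
      using assms False by (intro mult_le_mono1 binomial_le_pow) simp
    moreover have "1 \<le> n\<^sup>2" using assms by simp
    ultimately show ?thesis by linarith
  qed
  also have "\<dots> = n\<^sup>2 * Suc R" by simp
  also have "\<dots> \<le> n\<^sup>2 * n ^ R"
  proof -
    have "Suc R \<le> 2 ^ R" by (simp add: Suc_leI)
    also have "\<dots> \<le> n ^ R" using assms False by (intro power_mono) auto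
    finally show ?thesis by (rule mult_le_mono2)
  qed
  finally show ?thesis by (simp add: power_add power2_eq_square mult.commute)
qed

text \<open>\<open>None\<close> stands for a silent block. It needs a code of its own, since a
  message always has exactly \<open>B\<close> bits.\<close>

locale flooding =
  fixes n R B q :: nat and chunk :: "(nat set \<times> nat) option \<Rightarrow> nat \<Rightarrow> message"
  assumes R_pos: "R > 0" and q_pos: "q > 0"
    and length_chunk: "length (chunk x j) = B"
    and chunk_inj: "x \<in> insert None (Some ` notices n R) \<Longrightarrow> y \<in> insert None (Some ` notices n R) \<Longrightarrow>
      (\<And>j. j < q \<Longrightarrow> chunk x j = chunk y j) \<Longrightarrow> x = y"
begin

text \<open>
  Blocks are numbered from 0; block \<open>m\<close> consists of the rounds \<open>m q + 1, \<dots>, m q + q\<close>. Edges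
  deleted in round \<open>a + 1\<close> are announced in block \<open>start a\<close>, the first one not to begin before
  that round.
\<close>

definition start :: "nat \<Rightarrow> nat" where
  "start a = (a + q - 1) div q"

definition detected :: "nat \<Rightarrow> nat set list \<Rightarrow> nat \<Rightarrow> nat set set" where
  "detected v Ns a = {{w, v} |w. w \<in> Ns ! a \<and> w \<notin> Ns ! Suc a}"

text \<open>The sender \<open>u\<close> is forgotten after decoding, but one and the same
  \<open>u\<close> must have delivered all \<open>q\<close> chunks of the block.\<close>

definition received :: "observation list \<Rightarrow> nat \<Rightarrow> (nat set \<times> nat) set" where
  "received h m = {x \<in> notices n R. \<exists>u. \<forall>j<q. snd (h ! (m * q + j)) u = Some (chunk (Some x) j)}"

definition candidates ::
    "nat \<Rightarrow> nat set list \<Rightarrow> observation list \<Rightarrow> nat \<Rightarrow> (nat set \<times> nat) set" where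
  "candidates v Ns h m = {(e, 0) |e. \<exists>a. start a = m \<and> e \<in> detected v Ns a}
     \<union> {(e, Suc k) |e k. m > 0 \<and> (e, k) \<in> received h (m - 1) \<and> Suc k < R}"

text \<open>It is recomputed in every round of a block from a longer history;
  \<open>notice_hist\<close> shows that the result stays the same within a block.\<close>

definition notice ::
    "nat \<Rightarrow> nat ugraph \<Rightarrow> observation list \<Rightarrow> nat set \<Rightarrow> (nat set \<times> nat) option" where
  "notice v G0 h N =
     (let C = candidates v (neighbors G0 v # map fst h @ [N]) h (length h div q)
      in if C = {} then None else Some (SOME x. x \<in> C))"

definition known :: "nat \<Rightarrow> nat ugraph \<Rightarrow> observation list \<Rightarrow> nat set set" where
  "known v G0 h = {e. \<exists>a < length h. e \<in> detected v (neighbors G0 v # map fst h) a}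
     \<union> {e. \<exists>m k. Suc m * q \<le> length h \<and> (e, k) \<in> received h m}"

definition flood :: "'o problem \<Rightarrow> 'o algorithm" where
  "flood P = \<lparr>send = \<lambda>v G0 h N u. chunk (notice v G0 h N) (length h mod q),
     out = \<lambda>v G0 h. P (G0\<lparr>edges := edges G0 - known v G0 h\<rparr>) v\<rparr>"

lemma send_flood: "send (flood P) v G0 h N u = chunk (notice v G0 h N) (length h mod q)"
  by (simp add: flood_def)

lemma has_bandwidth_flood: "has_bandwidth (flood P) B"
  by (simp add: has_bandwidth_def send_flood length_chunk)

lemma le_start: "a \<le> start a * q" and start_le: "start a * q \<le> a + q - 1"
proof -
  have "(a + q - 1) div q * q + (a + q - 1) mod q = a + q - 1" by simp
  moreover have "(a + q - 1) mod q < q" using q_pos by simp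
  ultimately show "a \<le> start a * q" "start a * q \<le> a + q - 1"
    unfolding start_def by linarith+
qed

end

section \<open>A single execution: what is sent and observed\<close>

locale flooding_run = flooding n R B q chunk
  for n R B q :: nat and chunk :: "(nat set \<times> nat) option \<Rightarrow> nat \<Rightarrow> message" +
  fixes r :: nat and G :: "nat \<Rightarrow> nat ugraph" and P :: "'o problem"
  assumes blocks_fit: "(R + 1) * q \<le> r + 1"
    and deletion_sequence: "deletion_sequence n G" and spaced: "spaced r G"
begin

lemma r_pos: "r > 0"
proof -
  have "2 * 1 \<le> (R + 1) * q" using R_pos q_pos by (intro mult_le_mono) auto
  then show ?thesis using blocks_fit by linarith
qed

abbreviation hist :: "nat \<Rightarrow> nat \<Rightarrow> observation list" where
  "hist \<equiv> history (flood P) G"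

definition deleted :: "nat \<Rightarrow> nat set \<Rightarrow> bool" where
  "deleted a e \<longleftrightarrow> e \<in> edges (G a) - edges (G (Suc a))"

definition sent :: "nat \<Rightarrow> nat \<Rightarrow> (nat set \<times> nat) option" where
  "sent v m = notice v (G 0) (hist (m * q) v) (neighbors (G (Suc (m * q))) v)"

text \<open>Counterpart of \<open>candidates\<close> that refers to the true deletions instead of
  the observed neighbor lists.\<close>

definition cands :: "nat \<Rightarrow> nat \<Rightarrow> (nat set \<times> nat) set" where
  "cands v m = {(e, 0) |e. \<exists>a. start a = m \<and> v \<in> e \<and> deleted a e}
     \<union> {(e, Suc k) |e k. m > 0 \<and> (e, k) \<in> received (hist (m * q) v) (m - 1) \<and> Suc k < R}"

lemma edge_props:
  assumes "e \<in> edges (G i)"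
  shows "e \<subseteq> {1..n}" "card e = 2"
proof -
  have "e \<in> edges (G 0)" using assms deletion_sequence_antimono[OF deletion_sequence, of 0 i] by auto
  then show "e \<subseteq> {1..n}" "card e = 2"
    using deletion_sequence unfolding deletion_sequence_def simple_graph_def by auto
qed

lemma detected_iff:
  assumes "Ns ! a = neighbors (G a) v" "Ns ! Suc a = neighbors (G (Suc a)) v"
  shows "e \<in> detected v Ns a \<longleftrightarrow> v \<in> e \<and> deleted a e"
proof
  assume "e \<in> detected v Ns a"
  then show "v \<in> e \<and> deleted a e"
    using assms unfolding detected_def deleted_def neighbors_def by auto
next
  assume *: "v \<in> e \<and> deleted a e"
  then have "card e = 2" using edge_props unfolding deleted_def by auto
  then obtain x y where "e = {x, y}" by (auto simp: card_2_iff)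
  with * obtain w where "e = {w, v}" by (auto simp: insert_commute)
  then show "e \<in> detected v Ns a"
    using * assms unfolding detected_def deleted_def neighbors_def by auto
qed

lemma received_hist_eq:
  assumes "Suc m * q \<le> s" "Suc m * q \<le> t"
  shows "received (hist s v) m = received (hist t v) m"
proof -
  have "hist s v ! (m * q + j) = hist t v ! (m * q + j)" if "j < q" for j
    using assms that by (simp add: nth_history)
  then show ?thesis unfolding received_def by simp
qed

text \<open>Everything a notice of block \<open>m\<close> depends on is visible in the first round
  of the block: block \<open>m - 1\<close> is complete, and \<open>start a = m\<close> implies that
  \<open>a\<close> is at most \<open>m * q\<close>. If \<open>a = m * q\<close>, the deletion shows
  in the current neighbor list.\<close>

lemma notice_hist:
  assumes "s div q = m"
  shows "notice v (G 0) (hist s v) (neighbors (G (Suc s)) v)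
    = (if cands v m = {} then None else Some (SOME x. x \<in> cands v m))"
proof -
  let ?Ns = "neighbors (G 0) v # map fst (hist s v) @ [neighbors (G (Suc s)) v]"
  have s: "m * q \<le> s" using assms by (metis div_times_less_eq_dividend)
  have "e \<in> detected v ?Ns a \<longleftrightarrow> v \<in> e \<and> deleted a e" if "start a = m" for e a
    using le_start[of a] that s by (intro detected_iff nth_neighbor_lists) auto
  moreover have "received (hist s v) (m - 1) = received (hist (m * q) v) (m - 1)" if "m > 0"
    using that s by (intro received_hist_eq) auto
  ultimately have "candidates v ?Ns (hist s v) m = cands v m"
    unfolding candidates_def cands_def by blast
  then show ?thesis unfolding notice_def Let_def by (simp add: assms)
qed

lemma sent_eq: "sent v m = (if cands v m = {} then None else Some (SOME x. x \<in> cands v m))"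
proof -
  have "m * q div q = m" using q_pos by simp
  from notice_hist[OF this] show ?thesis unfolding sent_def .
qed

lemma observation:
  assumes "m * q + j < t" "j < q"
  shows "snd (hist t v ! (m * q + j)) u
    = (if u \<in> neighbors (G (Suc (m * q + j))) v then Some (chunk (sent u m) j) else None)"
proof -
  have "(m * q + j) div q = m" "(m * q + j) mod q = j" using assms(2) by auto
  then show ?thesis
    using assms(1) by (simp add: nth_history send_flood notice_hist sent_eq)
qed

section \<open>Invariant of the transmitted notices\<close>

text \<open>The hop count of a notice is the age of its flood in blocks.\<close>

definition valid :: "nat \<Rightarrow> nat set \<times> nat \<Rightarrow> bool" where
  "valid m x \<longleftrightarrow> (\<exists>a. deleted a (fst x) \<and> start a + snd x = m \<and> snd x < R)"

lemma valid_notice: "valid m x \<Longrightarrow> x \<in> notices n R"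
  unfolding valid_def notices_def deleted_def using edge_props by (cases x) fastforce

text \<open>Decoding is unambiguous only among notices, so the blocks sent must be known to be
  valid; the induction in \<open>cands_valid\<close> supplies this.\<close>

lemma received_sent:
  assumes "\<And>u x. sent u m = Some x \<Longrightarrow> valid m x"
    and "x \<in> received (hist t v) m" "Suc m * q \<le> t"
  shows "\<exists>u. sent u m = Some x"
proof -
  obtain u where x: "x \<in> notices n R"
    and u: "\<And>j. j < q \<Longrightarrow> snd (hist t v ! (m * q + j)) u = Some (chunk (Some x) j)"
    using assms(2) unfolding received_def by auto
  have "sent u m = Some x"
  proof (rule chunk_inj)
    show "sent u m \<in> insert None (Some ` notices n R)"
      using assms(1) valid_notice by (cases "sent u m") blast+
    show "Some x \<in> insert None (Some ` notices n R)" using x by simp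
    show "chunk (sent u m) j = chunk (Some x) j" if "j < q" for j
      using u[OF that] observation[of m j t v u] that assms(3) by (auto split: if_splits)
  qed
  then show ?thesis by blast
qed

lemma sent_in_cands: "sent v m = Some x \<Longrightarrow> x \<in> cands v m"
  unfolding sent_eq by (metis ex_in_conv option.distinct(1) option.inject someI_ex)

text \<open>Forwarding takes one block and raises the hop count by one, so the deletion and its
  starting block are preserved.\<close>

lemma cands_valid: "x \<in> cands v m \<Longrightarrow> valid m x"
proof (induction m arbitrary: v x)
  case (Suc m)
  have *: "valid m y" if "sent u m = Some y" for u y
    using that Suc.IH[of y u] sent_in_cands by blast
  show ?case
  proof (cases "snd x = 0")
    case True
    then show ?thesis using Suc.prems R_pos unfolding cands_def valid_def by auto
  next
    case False
    then obtain e k where x: "x = (e, Suc k)" "(e, k) \<in> received (hist (Suc m * q) v) m" "Suc k < R"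
      using Suc.prems unfolding cands_def by auto
    then obtain u where "sent u m = Some (e, k)"
      using received_sent[of m "(e, k)"] * by blast
    from *[OF this] show ?thesis using x unfolding valid_def by auto
  qed
qed (use R_pos in \<open>auto simp: cands_def valid_def\<close>)

lemma sent_valid: "sent u m = Some x \<Longrightarrow> valid m x"
  using cands_valid sent_in_cands by blast

lemma received_valid:
  assumes "x \<in> received (hist t v) m" "Suc m * q \<le> t"
  shows "valid m x"
proof -
  have "\<exists>u. sent u m = Some x" by (rule received_sent[OF _ assms]) (rule sent_valid)
  then show ?thesis using sent_valid by blast
qed

section \<open>Timing: floods do not overlap\<close>

text \<open>The left side is the last round of the last block of the flood. Round
  \<open>a + r\<close> ends the period that is change-free after a deletion in round
  \<open>a + 1\<close>.\<close>

lemma flood_end: "(start a + R) * q \<le> a + r"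
  using start_le[of a] blocks_fit q_pos by (simp add: algebra_simps)

lemma change_at_deleted: "deleted a e \<Longrightarrow> change_at G (Suc a)"
  unfolding deleted_def change_at_def by auto

lemma constant_after_deletion:
  assumes "deleted a e" "a < s" "s \<le> a + r"
  shows "G s = G (Suc a)"
  using spaced change_at_deleted[OF assms(1)] assms(2,3) unfolding spaced_def
  by (intro no_change_eq[of "Suc a" "Suc a + r"]) auto

text \<open>All notices alive in a block stem from one deletion round, which removes only one edge;
  the block number then fixes the hop count.\<close>

lemma valid_unique:
  assumes "valid m x" "valid m y"
  shows "x = y"
proof -
  obtain a b where a: "deleted a (fst x)" "start a + snd x = m" "snd x < R"
    and b: "deleted b (fst y)" "start b + snd y = m" "snd y < R"
    using assms unfolding valid_def by blast
  \<comment> \<open>A later deletion has \<open>b\<close> at least \<open>a + r\<close>, so its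
    flood cannot start before block \<open>start a + R\<close>, when the flood of \<open>a\<close>
    is over.\<close>
  have later: False
    if "deleted a e" "deleted b e'" "a < b" "start a + R > start b" for a b e e'
  proof -
    have "Suc b > a + r"
    proof (rule ccontr)
      assume "\<not> Suc b > a + r"
      then have "Suc b \<in> {Suc a <..< Suc a + r}" using that(3) by auto
      then show False
        using spaced change_at_deleted[OF that(1)] change_at_deleted[OF that(2)]
        unfolding spaced_def by blast
    qed
    moreover have "Suc (start b) * q \<le> (start a + R) * q"
      using that(4) by (intro mult_le_mono1) simp
    ultimately show False
      using flood_end[of a] le_start[of b] q_pos by simp
  qed
  have "start a < start b + R" "start b < start a + R" using a(2,3) b(2,3) by linarith+
  then have "\<not> a < b" "\<not> b < a" using later a(1) b(1) by blast+
  then have "a = b" by simp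
  moreover have "fst x = fst y"
    using a(1) b(1) deletion_sequence_step(3)[OF deletion_sequence, of "fst x" a]
    unfolding \<open>a = b\<close> deleted_def by auto
  ultimately show ?thesis using a b by (auto simp: prod_eq_iff)
qed

text \<open>By uniqueness the choice operator has only one candidate, so no notice displaces
  another.\<close>

lemma sent_cands: "x \<in> cands v m \<Longrightarrow> sent v m = Some x"
  unfolding sent_eq using valid_unique cands_valid
  by (metis empty_iff someI_ex)

section \<open>Spread of a flood\<close>

text \<open>The graph does not change while the flood lasts, so the edge carries all
  \<open>q\<close> chunks of the block.\<close>

lemma received_from_neighbor:
  assumes "deleted a e" "k < R" "sent u (start a + k) = Some (e, k)"
    and "{u, v} \<in> edges (G (Suc a))" "(start a + Suc k) * q \<le> t"
  shows "(e, k) \<in> received (hist t v) (start a + k)"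
proof -
  have "snd (hist t v ! ((start a + k) * q + j)) u = Some (chunk (Some (e, k)) j)" if "j < q" for j
  proof -
    let ?s = "(start a + k) * q + j"
    have "?s < (start a + Suc k) * q" using that by simp
    moreover have "(start a + Suc k) * q \<le> (start a + R) * q" using assms(2) by (intro mult_le_mono1) simp
    moreover have "a \<le> ?s" using le_start[of a] by (simp add: algebra_simps)
    ultimately have "G (Suc ?s) = G (Suc a)" and "?s < t"
      using flood_end[of a] assms(5) by (auto intro!: constant_after_deletion[OF assms(1)])
    then show ?thesis
      using observation[OF \<open>?s < t\<close> that, of v u] assms(3,4) by (simp add: neighbors_def)
  qed
  then show ?thesis
    using valid_notice[OF sent_valid[OF assms(3)]] unfolding received_def by blast
qed

text \<open>The walk runs from the receiver to \<open>e\<close>, so the induction removes the node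
  reached last. Walks need not be shortest: a node may send the same notice again in a later block
  with a larger hop count.\<close>

lemma flood_along_walk:
  assumes "deleted a e" "p \<noteq> []" "last p \<in> e" "length p \<le> R"
    and "successively (\<lambda>x y. {x, y} \<in> edges (G (Suc a))) p"
  shows "sent (hd p) (start a + (length p - 1)) = Some (e, length p - 1)"
  using assms(2-)
proof (induction p)
  case (Cons v p)
  show ?case
  proof (cases "p = []")
    case True
    then show ?thesis
      using Cons.prems assms(1) by (intro sent_cands) (auto simp: cands_def)
  next
    case False
    then have *: "sent (hd p) (start a + (length p - 1)) = Some (e, length p - 1)"
      and edge: "{hd p, v} \<in> edges (G (Suc a))"
      using Cons by (auto simp: successively_Cons insert_commute)
    obtain k where k: "length p = Suc k" using False by (cases p) auto
    have "(e, k) \<in> received (hist ((start a + Suc k) * q) v) (start a + k)"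
      using received_from_neighbor[OF assms(1) _ _ edge, of k] * k Cons.prems by simp
    then show ?thesis
      using Cons.prems k by (intro sent_cands) (auto simp: cands_def)
  qed
qed simp

section \<open>Soundness and completeness of what nodes know\<close>

lemma detected_hist:
  assumes "a < t"
  shows "e \<in> detected v (neighbors (G 0) v # map fst (hist t v)) a \<longleftrightarrow> v \<in> e \<and> deleted a e"
proof (rule detected_iff)
  have "(neighbors (G 0) v # map fst (hist t v)) ! i = neighbors (G i) v" if "i \<le> t" for i
    using that by (cases i) (auto simp: nth_history)
  from this[of a] this[of "Suc a"]
  show "(neighbors (G 0) v # map fst (hist t v)) ! a = neighbors (G a) v"
    "(neighbors (G 0) v # map fst (hist t v)) ! Suc a = neighbors (G (Suc a)) v"
    using assms by simp_all
qed

text \<open>A received notice is valid and its flood started after the deletion; deleted edges never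
  return.\<close>

lemma known_sound:
  assumes "e \<in> known v (G 0) (hist t v)"
  shows "e \<notin> edges (G t)"
proof -
  have "\<exists>a<t. deleted a e"
  proof (cases "\<exists>a<t. e \<in> detected v (neighbors (G 0) v # map fst (hist t v)) a")
    case True
    then show ?thesis using detected_hist by blast
  next
    case False
    then obtain m k where mk: "Suc m * q \<le> t" "(e, k) \<in> received (hist t v) m"
      using assms unfolding known_def by auto
    then have "valid m (e, k)" by (intro received_valid)
    then obtain a where a: "deleted a e" "start a + k = m" unfolding valid_def by auto
    have "start a * q \<le> m * q" using a(2) by (intro mult_le_mono1) simp
    moreover have "m * q < t" using mk(1) q_pos by simp
    ultimately have "a < t" using le_start[of a] by linarith
    then show ?thesis using a(1) by blast
  qed
  then show ?thesis
    using deletion_sequence_antimono[OF deletion_sequence] unfolding deleted_def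
    by (metis DiffD2 Suc_leI subsetD)
qed

text \<open>The walk may have one node more than in \<open>flood_along_walk\<close>, because its
  first node only has to receive the notice and not to forward it.\<close>

lemma known_complete:
  assumes "deleted a e" "p \<noteq> []" "last p \<in> e" "length p \<le> Suc R"
    and "successively (\<lambda>x y. {x, y} \<in> edges (G (Suc a))) p" "a + r \<le> t"
  shows "e \<in> known (hd p) (G 0) (hist t (hd p))"
proof -
  obtain v p' where p: "p = v # p'" using assms(2) by (cases p) auto
  show ?thesis
  proof (cases "p' = []")
    case True
    have "a < t" using assms(6) r_pos by simp
    then have "e \<in> detected v (neighbors (G 0) v # map fst (hist t v)) a"
      using True assms(1,3) p detected_hist by auto
    then show ?thesis using \<open>a < t\<close> unfolding known_def p by auto
  next
    case False
    then obtain k where k: "length p' = Suc k" by (cases p') auto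
    have "sent (hd p') (start a + k) = Some (e, k)"
      using flood_along_walk[OF assms(1), of p'] assms False k by (simp add: p successively_Cons)
    moreover have "{hd p', v} \<in> edges (G (Suc a))"
      using assms(5) False by (simp add: p successively_Cons insert_commute)
    moreover have "k < R" using assms(4) k p by simp
    moreover have "(start a + Suc k) * q \<le> (start a + R) * q"
      using \<open>k < R\<close> by (intro mult_le_mono1) simp
    then have t: "(start a + Suc k) * q \<le> t" using flood_end[of a] assms(6) by linarith
    ultimately have "(e, k) \<in> received (hist t v) (start a + k)"
      using assms(1) by (intro received_from_neighbor)
    moreover have "Suc (start a + k) * q \<le> length (hist t v)" using t by simp
    ultimately show ?thesis unfolding known_def p list.sel(1) by blast
  qed
qed

end

section \<open>Correctness for membership listing\<close>

lemma (in flooding) flood_solves_MemList: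
  fixes H :: "'h ugraph"
  assumes "simple_graph H" "round_threshold H = enat R" "(R + 1) * q \<le> r + 1"
  shows "solves (flood (MemList H)) (MemList H) r n"
  unfolding solves_def
proof (intro allI impI ballI)
  fix G i v
  assume run: "deletion_sequence n G \<and> spaced r G" and quiet: "\<forall>j\<in>{i<..<i + r}. \<not> change_at G j"
    and "v \<in> {1..n}"
  interpret flooding_run n R B q chunk r G "MemList H"
    by unfold_locales (use assms(3) run in \<open>simp_all only:\<close>)
  let ?t = "i + r - 1"
  let ?K = "known v (G 0) (hist ?t v)"
  have Gt: "G ?t = G i" by (rule no_change_eq[OF quiet]) (use r_pos in simp_all)
  have diam: "node_edge_diam H \<le> enat (Suc R)"
    using assms(2) unfolding round_threshold_def
    by (cases "node_edge_diam H") (auto simp: one_enat_def)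
  \<comment> \<open>The graph used for the output may retain deleted edges far from
    \<open>v\<close>; it suffices that it contains the same copies of \<open>H\<close> through
    \<open>v\<close> as \<open>G i\<close>.\<close>
  have "edges S \<subseteq> edges (G i) \<longleftrightarrow> edges S \<subseteq> edges (G 0) - ?K"
    if S: "graph_iso H S" "v \<in> verts S" for S
  proof
    assume "edges S \<subseteq> edges (G i)"
    then show "edges S \<subseteq> edges (G 0) - ?K"
      using deletion_sequence_antimono[OF deletion_sequence, of 0 i] known_sound[of _ v ?t] Gt by auto
  next
    assume sub: "edges S \<subseteq> edges (G 0) - ?K"
    show "edges S \<subseteq> edges (G i)"
    proof (rule ccontr)
      assume contr: "\<not> edges S \<subseteq> edges (G i)"
      \<comment> \<open>At the first round that breaks \<open>S\<close>, only one edge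
        \<open>e\<close> of \<open>S\<close> is missing, so walks in the rest of \<open>S\<close>
        can carry the notice.\<close>
      define b where "b = (LEAST b. \<not> edges S \<subseteq> edges (G b))"
      have b: "\<not> edges S \<subseteq> edges (G b)" "b \<le> i" "\<And>c. c < b \<Longrightarrow> edges S \<subseteq> edges (G c)"
        unfolding b_def
        using LeastI[of "\<lambda>b. \<not> edges S \<subseteq> edges (G b)", OF contr]
          Least_le[of "\<lambda>b. \<not> edges S \<subseteq> edges (G b)", OF contr] not_less_Least
        by blast+
      obtain a where a: "b = Suc a" using b(1) sub by (cases b) auto
      obtain e where e: "e \<in> edges S" "e \<notin> edges (G (Suc a))" using b(1) a by auto
      then have del: "deleted a e" using b(3) a unfolding deleted_def by auto
      have rest: "edges S - {e} \<subseteq> edges (G (Suc a))"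
        using deletion_sequence_step(3)[OF deletion_sequence, of e a] del b(3) a
        unfolding deleted_def by auto
      obtain f where f: "bij_betw f (verts H) (verts S)" "edges S = (\<lambda>e. f ` e) ` edges H"
        using S(1) unfolding graph_iso_def by blast
      have "v \<in> f ` verts H" using bij_betw_imp_surj_on[OF f(1)] S(2) by simp
      then obtain u where u: "u \<in> verts H" "f u = v" by blast
      obtain e' where e': "e' \<in> edges H" "e = f ` e'" using e(1) f(2) by auto
      have "card e' = 2" using e'(1) assms(1) unfolding simple_graph_def by auto
      then obtain p where p: "p \<noteq> []" "hd p = u" "last p \<in> e'" "length p \<le> Suc R"
        "successively (\<lambda>x y. {x, y} \<in> edges H) p"
        using node_edge_diam_walk[OF diam u(1) e'(1)] by blast
      have "successively (\<lambda>x y. {x, y} \<in> edges S) (map f p)"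
        unfolding successively_map
      proof (rule successively_mono[OF p(5)])
        fix x y assume "{x, y} \<in> edges H"
        then have "f ` {x, y} \<in> edges S" unfolding f(2) by (rule imageI)
        then show "{f x, f y} \<in> edges S" by simp
      qed
      then obtain p' where p': "p' \<noteq> []" "hd p' = v" "last p' \<in> e" "length p' \<le> Suc R"
        "successively (\<lambda>x y. {x, y} \<in> edges S - {e}) p'"
        using walk_avoiding_edge[of "map f p" e "edges S"] p u e'(2)
        by (auto simp: last_map hd_map)
      have "successively (\<lambda>x y. {x, y} \<in> edges (G (Suc a))) p'"
        using rest by (intro successively_mono[OF p'(5)]) blast
      moreover have "a + r \<le> ?t" using b(2) a by simp
      ultimately have "e \<in> ?K"
        using known_complete[OF del p'(1,3,4)] p'(2) by simp
      then show False using sub e(1) by auto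
    qed
  qed
  then show "output_at (flood (MemList H)) G ?t v = MemList H (G i) v"
    using deletion_sequence_verts[OF deletion_sequence]
    unfolding output_at_def by (auto simp: MemList_def subgraph_def flood_def[of "MemList H"])
qed

theorem theorem5p10:
  fixes H :: "'h ugraph"
  assumes "simple_graph H" and "connected_graph H" and "card (verts H) \<ge> 3"
  shows "\<exists>C::real. C > 0 \<and> (\<forall>r n :: nat. enat r \<ge> round_threshold H \<and> n \<ge> 1 \<longrightarrow>
    bandwidth_complexity (MemList H) r n \<le> enat (nat \<lceil>C * (log 2 (real n) / real r)\<rceil>))"
proof (cases "round_threshold H")
  case infinity
  \<comment> \<open>No finite \<open>r\<close> reaches an infinite threshold, so any positive
    constant will do.\<close>
  then show ?thesis by (intro exI[of _ 1]) simp
next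
  case (enat R)
  have "R \<ge> 1"
    using node_edge_diam_ge_2[OF assms] enat unfolding round_threshold_def
    by (cases "node_edge_diam H") (auto simp: one_enat_def numeral_eq_enat)
  \<comment> \<open>This is the constant of \<open>block_capacity\<close>; it depends only on
    \<open>H\<close>.\<close>
  let ?C = "real (2 * (R + 1) * (R + 2))"
  have "bandwidth_complexity (MemList H) r n \<le> enat (nat \<lceil>?C * (log 2 (real n) / real r)\<rceil>)"
    if "enat r \<ge> round_threshold H" "n \<ge> 1" for r n
  proof -
    define q where "q = (r + 1) div (R + 1)"
    define B where "B = nat \<lceil>?C * (log 2 (real n) / real r)\<rceil>"
    have "r \<ge> R" using that(1) enat by simp
    let ?X = "insert None (Some ` notices n R)"
    have "card ?X \<le> 2 ^ (q * B)"
      using card_notices[OF that(2), of R] block_capacity[OF that(2) \<open>r \<ge> R\<close> \<open>R \<ge> 1\<close>]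
      unfolding q_def B_def by linarith
    moreover have "finite ?X" by (simp add: finite_notices)
    ultimately obtain chunk :: "(nat set \<times> nat) option \<Rightarrow> nat \<Rightarrow> message"
      where "\<And>x j. length (chunk x j) = B"
        and "\<forall>x\<in>?X. \<forall>y\<in>?X. (\<forall>j<q. chunk x j = chunk y j) \<longrightarrow> x = y"
      using ex_block_code[of ?X q B] by metis
    moreover have "q > 0" unfolding q_def using \<open>r \<ge> R\<close> by (simp add: div_greater_zero_iff)
    ultimately interpret flooding n R B q chunk
      using \<open>R \<ge> 1\<close> by unfold_locales (assumption | linarith | blast)+
    have "(R + 1) * q \<le> r + 1" unfolding q_def by (rule times_div_less_eq_dividend)
    then have "solves (flood (MemList H)) (MemList H) r n"
      by (intro flood_solves_MemList assms(1) enat)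
    then show ?thesis
      unfolding bandwidth_complexity_def B_def[symmetric]
      using has_bandwidth_flood by (intro INF_lower) blast
  qed
  moreover have "?C > 0" by (simp only: of_nat_0_less_iff) simp
  ultimately show ?thesis by blast
qed

end
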